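(* Let $p$ be a prime. If $A\in SL_2(\mathbb{F}_p)$ is a simple matrix and $\left(\frac{\operatorname{tr}(A)+2}{p}\right)=1$, then $$\sqrt{A}=\frac{1}{\pm\sqrt{\operatorname{tr}A\pm 2}}\,(A\pm E),$$ where $E$ is the identity element of $SL_2(\mathbb{F}_p)$; in the case of the sign "$-$" in $(A\pm E)$ the roots $\sqrt{A}$ lie in $ESL_2(\mathbb{F}_p)$. Namely, for $A=\begin{pmatrix} a & b\\ c & d\end{pmatrix}$, in coordinate form, in the case $\sqrt{A}\in SL_2(\mathbb{F}_p)$ we have $$\sqrt{A}=\frac{1}{\pm\sqrt{\operatorname{tr}(A)+2}}\begin{pmatrix} a+1 & b\\ c & d+1\end{pmatrix}.$$
   Context: $\left(\frac{\cdot}{p}\right)$ is the Legendre symbol, so the hypothesis says that $\operatorname{tr}(A)+2$ is a nonzero square in $\mathbb{F}_p$. $\sqrt{A}$ denotes a matrix $B$ with $B^2=A$. $ESL_2(\mathbb{F}_p)=\{M\in GL_2(\mathbb{F}_p) : \det M=\pm 1\}$. A $2\times 2$ matrix over a field is simple if its characteristic polynomial has two distinct roots in an algebraic closure. In the displayed formula the sign in $\operatorname{tr}A\pm 2$ is the same as the sign in $A\pm E$, while the sign in front of the square root is independent. *)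

theory Defs
  imports
    "Jordan_Normal_Form.Char_Poly"
    "Berlekamp_Zassenhaus.Finite_Field"
    "HOL-Number_Theory.Residues"
    "HOL-Algebra.Algebraic_Closure_Type"
begin

definition tr :: "'a::comm_ring_1 mat \<Rightarrow> 'a" where
  "tr A = sum_list (diag_mat A)"

definition GL2 :: "'a::field mat set" where
  "GL2 = {M \<in> carrier_mat 2 2. invertible_mat M}"

definition SL2 :: "'a::field mat set" where
  "SL2 = {M \<in> carrier_mat 2 2. det M = 1}"

definition ESL2 :: "'a::field mat set" where
  "ESL2 = {M \<in> GL2. det M = 1 \<or> det M = -1}"

definition simple_mat2 :: "'a::field mat \<Rightarrow> bool" where
  "simple_mat2 A \<longleftrightarrow> A \<in> carrier_mat 2 2 \<and>
     (\<exists>x y :: 'a alg_closure. x \<noteq> y \<and>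
        poly (map_poly to_ac (char_poly A)) x = 0 \<and>
        poly (map_poly to_ac (char_poly A)) y = 0)"

(* The type 'p mod_ring with 'p :: prime_card is the field of integers modulo the
   prime CARD('p); its elements are represented by residues 0, ..., CARD('p) - 1. *)
definition legendre_mod :: "'p::prime_card mod_ring \<Rightarrow> int" where
  "legendre_mod x = Legendre (to_int_mod_ring x) (int CARD('p))"

definition sqrt_mats :: "'a::field mat \<Rightarrow> 'a mat set" where
  "sqrt_mats A = {B \<in> carrier_mat 2 2. B * B = A}"

end

theory Submission
  imports Defs
begin

text \<open>
  If \<open>B\<^sup>2 = A\<close> and \<open>e = det B\<close>, then \<open>e = \<plusminus>1\<close>, and the Cayley-Hamilton theorem gives
  \<open>tr B \<cdot> B = A + e E\<close> and \<open>(tr B)\<^sup>2 = tr A + 2 e\<close>. Conversely, Cayley-Hamilton for \<open>A\<close> shows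
  \<open>(A + e E)\<^sup>2 = (tr A + 2 e) A\<close>. Since \<open>A\<close> is simple, its discriminant
  \<open>(tr A + 2) (tr A - 2)\<close> does not vanish, so in both cases one can divide by \<open>tr B\<close>.
\<close>

text \<open>This is the literal form in which the theorem writes its coordinate matrices, so
  entrywise facts about \<open>mat2\<close> apply there without conversion.\<close>

abbreviation mat2 :: "'a \<Rightarrow> 'a \<Rightarrow> 'a \<Rightarrow> 'a \<Rightarrow> 'a mat" where
  "mat2 a b c d \<equiv> mat_of_rows_list 2 [[a, b], [c, d]]"

lemma mat2_carrier: "mat2 a b c d \<in> carrier_mat 2 2"
  by (auto simp: mat_of_rows_list_def)

lemma mat2_index:
  "mat2 a b c d $$ (0, 0) = a" "mat2 a b c d $$ (0, Suc 0) = b"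
  "mat2 a b c d $$ (Suc 0, 0) = c" "mat2 a b c d $$ (Suc 0, Suc 0) = d"
  by (auto simp: mat_of_rows_list_def)

lemma mat2_dim: "dim_row (mat2 a b c d) = 2" "dim_col (mat2 a b c d) = 2"
  by (auto simp: mat_of_rows_list_def)

lemma mat2_cases:
  assumes "A \<in> carrier_mat 2 2"
  obtains a b c d where "A = mat2 a b c d"
proof
  show "A = mat2 (A $$ (0, 0)) (A $$ (0, 1)) (A $$ (1, 0)) (A $$ (1, 1))"
    using assms by (intro eq_matI) (auto simp: mat2_index mat2_dim less_2_cases_iff)
qed

lemma mat2_eq_iff: "mat2 a b c d = mat2 a' b' c' d' \<longleftrightarrow> a = a' \<and> b = b' \<and> c = c' \<and> d = d'"
  by (metis mat2_index)

lemma mat2_mult: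
  "mat2 a b c d * mat2 a' b' c' (d' :: 'a :: semiring_0) =
    mat2 (a * a' + b * c') (a * b' + b * d') (c * a' + d * c') (c * b' + d * d')"
  by (intro eq_matI)
    (auto simp: mat2_index mat2_dim less_2_cases_iff scalar_prod_def
      sum.atLeast0_lessThan_Suc[of _ "Suc 0", folded numeral_2_eq_2])

lemma mat2_smult: "k \<cdot>\<^sub>m mat2 a b c d = mat2 (k * a) (k * b) (k * c) (k * d)"
  by (intro eq_matI) (auto simp: mat2_index mat2_dim less_2_cases_iff)

lemma mat2_add_one: "mat2 a b c d + 1\<^sub>m 2 = mat2 (a + 1) b c (d + 1 :: 'a :: semiring_1)"
  by (intro eq_matI) (auto simp: mat2_index mat2_dim less_2_cases_iff)

lemma mat2_add_scalar:
  "mat2 a b c d + e \<cdot>\<^sub>m 1\<^sub>m 2 = mat2 (a + e) b c (d + e :: 'a :: semiring_1)"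
  by (intro eq_matI) (auto simp: mat2_index mat2_dim less_2_cases_iff)

lemma mat2_minus_one: "mat2 a b c d - 1\<^sub>m 2 = mat2 (a - 1) b c (d - 1 :: 'a :: ring_1)"
  by (intro eq_matI) (auto simp: mat2_index mat2_dim less_2_cases_iff)

lemma tr_mat2: "tr (mat2 a b c d) = a + d"
  by (simp add: tr_def diag_mat_def mat2_index mat2_dim upt_rec)

lemma det_mat2: "det (mat2 a b c d) = a * d - b * c"
  by (subst laplace_expansion_row[OF mat2_carrier, of 0])
    (auto simp: numeral_2_eq_2 cofactor_def mat_delete_def det_single
      mat2_index[unfolded numeral_2_eq_2] mat2_dim[unfolded numeral_2_eq_2])

lemma char_poly_mat2:
  "char_poly (mat2 a b c d) = [:a * d - b * c, - (a + d), 1:]"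
proof -
  have "char_poly_matrix (mat2 a b c d) = mat2 [:- a, 1:] [:- b:] [:- c:] [:- d, 1:]"
    by (intro eq_matI) (auto simp: char_poly_matrix_def mat2_index mat2_dim less_2_cases_iff)
  then show ?thesis
    by (simp add: char_poly_def det_mat2 algebra_simps)
qed

text \<open>By Vieta, two distinct roots \<open>x\<close>, \<open>y\<close> of the characteristic
  polynomial have sum \<open>tr A\<close> and product \<open>det A\<close>, so the discriminant is
  the nonzero square of \<open>x - y\<close>. Nothing is divided by 2, which keeps characteristic 2
  included.\<close>

lemma simple_mat2_imp_discriminant_nonzero:
  assumes "simple_mat2 A"
  shows "(tr A)\<^sup>2 \<noteq> 4 * det A"
proof
  assume disc: "(tr A)\<^sup>2 = 4 * det A"
  from assms have "A \<in> carrier_mat 2 2" by (simp add: simple_mat2_def)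
  then obtain a b c d where A: "A = mat2 a b c d" by (rule mat2_cases)
  define t where "t = to_ac (tr A)"
  define e where "e = to_ac (det A)"
  have "map_poly to_ac (char_poly A) = [:e, - t, 1:]"
    by (simp add: A char_poly_mat2 tr_mat2 det_mat2 t_def e_def)
  then obtain x y where xy: "x \<noteq> y" "e + x * (x - t) = 0" "e + y * (y - t) = 0"
    using assms by (auto simp: simple_mat2_def)
  \<comment> \<open>Subtracting the two root equations eliminates \<open>e\<close> and leaves the
    factor \<open>x - y\<close>, which can be cancelled.\<close>
  have "(x - y) * (x + y - t) = (e + x * (x - t)) - (e + y * (y - t))"
    by (simp add: algebra_simps)
  then have "(x - y) * (x + y - t) = 0" using xy by simp
  with xy have t: "t = x + y" by simp
  then have "e = x * y" using xy(2) by (simp add: algebra_simps)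
  moreover have "t\<^sup>2 = 4 * e"
    using arg_cong[OF disc, of to_ac] by (simp add: t_def e_def)
  ultimately have "(x + y)\<^sup>2 - 4 * (x * y) = 0" unfolding t by simp
  then have "(x - y)\<^sup>2 = 0" by (simp add: power2_eq_square algebra_simps)
  with xy show False by simp
qed

text \<open>The symbol takes the value 1 only in the branch of a quadratic residue; the integer root
  found there is reduced modulo the prime.\<close>

lemma square_root_if_legendre_mod_eq_1:
  assumes "legendre_mod x = 1"
  obtains s where "s\<^sup>2 = x"
proof -
  from assms have "QuadRes (int CARD('a)) (to_int_mod_ring x)"
    by (auto simp: legendre_mod_def Legendre_def split: if_splits)
  then obtain y where y: "[y\<^sup>2 = to_int_mod_ring x] (mod int CARD('a))"
    by (auto simp: QuadRes_def)
  have "(of_int y)\<^sup>2 = (of_int_mod_ring (y\<^sup>2) :: 'a mod_ring)"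
    by (simp flip: of_int_of_int_mod_ring)
  also have "\<dots> = of_int_mod_ring (to_int_mod_ring x)"
    using y unfolding cong_def by transfer simp
  finally show ?thesis using that by simp
qed

lemma mat_smult_smult: "k \<cdot>\<^sub>m (l \<cdot>\<^sub>m M) = (k * l :: 'a :: semigroup_mult) \<cdot>\<^sub>m M"
  by (intro eq_matI) (auto simp: mult.assoc)

lemma invertible_mat_if_det_nonzero:
  assumes "M \<in> carrier_mat n n" "det M \<noteq> (0 :: 'a :: field)"
  shows "invertible_mat M"
  \<comment> \<open>The argument \<open>()\<close> only fills the extension slot of the record for
    the matrix ring.\<close>
  using det_non_zero_imp_unit[OF assms, of "()"] assms(1)
  by (auto simp: Units_def ring_mat_simps invertible_mat_def inverts_mat_def)

text \<open>Cayley-Hamilton for \<open>B\<close>, arranged so that a root of \<open>A\<close> is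
  determined by its trace and determinant once the trace is nonzero.\<close>

lemma tr_smult_eq_square_add_det:
  assumes "B \<in> carrier_mat 2 2"
  shows "tr B \<cdot>\<^sub>m B = B * B + det B \<cdot>\<^sub>m 1\<^sub>m 2"
  using assms
  by (elim mat2_cases)
    (simp add: tr_mat2 det_mat2 mat2_mult mat2_smult mat2_add_scalar mat2_eq_iff algebra_simps)

text \<open>This is the trace of the Cayley-Hamilton identity.\<close>

lemma tr_power2:
  assumes "B \<in> carrier_mat 2 2"
  shows "(tr B)\<^sup>2 = tr (B * B) + 2 * det B"
  using assms
  by (elim mat2_cases) (simp add: tr_mat2 det_mat2 mat2_mult power2_eq_square algebra_simps)

text \<open>In the expanded square, \<open>A * A\<close> and the scalar part
  \<open>e\<^sup>2 = 1 = det A\<close> combine to \<open>tr A\<close> times \<open>A\<close> by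
  Cayley-Hamilton.\<close>

lemma square_add_scalar:
  fixes A :: "'a :: field mat"
  assumes "A \<in> carrier_mat 2 2" "det A = 1" "e\<^sup>2 = 1"
  shows "(A + e \<cdot>\<^sub>m 1\<^sub>m 2) * (A + e \<cdot>\<^sub>m 1\<^sub>m 2) = (tr A + 2 * e) \<cdot>\<^sub>m A"
proof -
  obtain a b c d where A: "A = mat2 a b c d" using assms(1) by (rule mat2_cases)
  \<comment> \<open>Writing the determinant 1 as \<open>e * e\<close> gives one rewrite rule that
    uses both hypotheses.\<close>
  have "a * d = e * e + b * c"
    using assms(2,3) by (simp add: A det_mat2 power2_eq_square algebra_simps)
  then show ?thesis
    unfolding A tr_mat2 mat2_add_scalar mat2_mult mat2_smult mat2_eq_iff
    by (simp add: algebra_simps)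
qed

text \<open>The left side is the characteristic polynomial of \<open>A\<close> at \<open>-e\<close>,
  with its constant term 1 replaced by \<open>e\<^sup>2\<close>.\<close>

lemma det_add_scalar:
  fixes A :: "'a :: field mat"
  assumes "A \<in> carrier_mat 2 2" "det A = 1" "e\<^sup>2 = 1"
  shows "det (A + e \<cdot>\<^sub>m 1\<^sub>m 2) = (tr A + 2 * e) * e"
proof -
  obtain a b c d where A: "A = mat2 a b c d" using assms(1) by (rule mat2_cases)
  have "a * d = e * e + b * c"
    using assms(2,3) by (simp add: A det_mat2 power2_eq_square algebra_simps)
  then show ?thesis
    unfolding A tr_mat2 mat2_add_scalar det_mat2 by (simp add: algebra_simps)
qed

text \<open>Sorting the roots by determinant treats both signs of the formula at once, as
  \<open>e = 1\<close> and \<open>e = -1\<close>; the scalar \<open>s\<close> is the trace of the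
  root.\<close>

lemma sqrt_mats_det_eq:
  fixes A :: "'a :: field mat"
  assumes "A \<in> SL2" "e\<^sup>2 = 1" "tr A + 2 * e \<noteq> 0"
  shows "{B \<in> sqrt_mats A. det B = e} =
    {inverse s \<cdot>\<^sub>m (A + e \<cdot>\<^sub>m 1\<^sub>m 2) | s. s\<^sup>2 = tr A + 2 * e}" (is "?L = ?R")
proof
  have A: "A \<in> carrier_mat 2 2" "det A = 1" using assms(1) by (auto simp: SL2_def)
  show "?L \<subseteq> ?R"
  proof
    fix B assume "B \<in> ?L"
    then have B: "B \<in> carrier_mat 2 2" "B * B = A" "det B = e" by (auto simp: sqrt_mats_def)
    have tr2: "(tr B)\<^sup>2 = tr A + 2 * e" using tr_power2[OF B(1)] B by simp
    then have "tr B \<noteq> 0" using assms(3) by auto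
    then have "B = inverse (tr B) \<cdot>\<^sub>m (tr B \<cdot>\<^sub>m B)"
      by (intro eq_matI) auto
    also have "tr B \<cdot>\<^sub>m B = A + e \<cdot>\<^sub>m 1\<^sub>m 2"
      using tr_smult_eq_square_add_det[OF B(1)] B by simp
    finally show "B \<in> ?R" using tr2 by blast
  qed
  show "?R \<subseteq> ?L"
  proof
    fix B assume "B \<in> ?R"
    then obtain s where s: "s\<^sup>2 = tr A + 2 * e"
      and B: "B = inverse s \<cdot>\<^sub>m (A + e \<cdot>\<^sub>m 1\<^sub>m 2)" by blast
    have s0: "s \<noteq> 0" using s assms(3) by auto
    let ?C = "A + e \<cdot>\<^sub>m 1\<^sub>m 2"
    have C: "?C \<in> carrier_mat 2 2" using A by simp
    have "B * B = (inverse s * inverse s) \<cdot>\<^sub>m (?C * ?C)"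
      unfolding B using C
      by (simp add: mult_smult_assoc_mat[of _ 2 2 _ 2] mult_smult_distrib[of _ 2 2 _ 2]
          mat_smult_smult)
    also have "\<dots> = (inverse s * inverse s * s\<^sup>2) \<cdot>\<^sub>m A"
      by (simp add: square_add_scalar A assms(2) mat_smult_smult s)
    also have "inverse s * inverse s * s\<^sup>2 = 1" using s0 by (simp add: power2_eq_square field_simps)
    also have "1 \<cdot>\<^sub>m A = A" by (intro eq_matI) auto
    finally have "B * B = A" .
    moreover have "det B = (inverse s)\<^sup>2 * det ?C"
      using C unfolding B by (simp add: det_smult)
    \<comment> \<open>By \<open>det_add_scalar\<close> and \<open>s\<close>, the determinant of
      \<open>?C\<close> is \<open>s\<^sup>2 * e\<close>, so the scaling cancels the square.\<close>
    then have "det B = e"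
      using s0 by (simp add: det_add_scalar A assms(2) power_inverse flip: s)
    moreover have "B \<in> carrier_mat 2 2" using C by (simp add: B)
    ultimately show "B \<in> ?L" by (simp add: sqrt_mats_def)
  qed
qed

lemma det_sqrt_mats:
  assumes "A \<in> SL2" "B \<in> sqrt_mats A"
  shows "det B = 1 \<or> det B = -1"
proof -
  from assms have "B \<in> carrier_mat 2 2" "det (B * B) = 1" by (auto simp: SL2_def sqrt_mats_def)
  then have "(det B)\<^sup>2 = 1" by (simp add: det_mult power2_eq_square)
  then show ?thesis by (simp add: power2_eq_1_iff)
qed

theorem proposition1:
  fixes A :: "'p::prime_card mod_ring mat"
  assumes "A \<in> SL2" and "simple_mat2 A" and "legendre_mod (tr A + 2) = 1"
  shows
    "tr A + 2 \<noteq> 0 \<and> tr A - 2 \<noteq> 0 \<and> (\<exists>s. s ^ 2 = tr A + 2) \<and>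
     sqrt_mats A =
       {inverse s \<cdot>\<^sub>m (A + 1\<^sub>m 2) | s. s ^ 2 = tr A + 2} \<union>
       {inverse s \<cdot>\<^sub>m (A - 1\<^sub>m 2) | s. s ^ 2 = tr A - 2} \<and>
     {inverse s \<cdot>\<^sub>m (A - 1\<^sub>m 2) | s. s ^ 2 = tr A - 2} \<subseteq> ESL2 \<and>
     (\<forall>a b c d s. A = mat_of_rows_list 2 [[a, b], [c, d]] \<longrightarrow> s ^ 2 = tr A + 2 \<longrightarrow>
        sqrt_mats A \<inter> SL2 =
          {inverse s \<cdot>\<^sub>m mat_of_rows_list 2 [[a + 1, b], [c, d + 1]],
           inverse (- s) \<cdot>\<^sub>m mat_of_rows_list 2 [[a + 1, b], [c, d + 1]]})"
proof (intro conjI allI impI)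
  have A: "A \<in> carrier_mat 2 2" "det A = 1" using assms(1) by (auto simp: SL2_def)
  \<comment> \<open>Since \<open>det A = 1\<close>, this product is the discriminant of
    \<open>A\<close>.\<close>
  have "(tr A + 2) * (tr A - 2) \<noteq> 0"
    using simple_mat2_imp_discriminant_nonzero[OF assms(2)] A
    by (simp add: algebra_simps power2_eq_square)
  then show plus: "tr A + 2 \<noteq> 0" and minus: "tr A - 2 \<noteq> 0" by auto
  show "\<exists>s. s\<^sup>2 = tr A + 2"
    using square_root_if_legendre_mod_eq_1[OF assms(3)] by blast
  have "A + (- 1) \<cdot>\<^sub>m 1\<^sub>m 2 = A - 1\<^sub>m 2" "A + 1 \<cdot>\<^sub>m 1\<^sub>m 2 = A + 1\<^sub>m 2"
    using A(1) by (auto elim!: mat2_cases simp: mat2_add_scalar mat2_minus_one mat2_add_one)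
  then have
    pos: "{B \<in> sqrt_mats A. det B = 1} =
      {inverse s \<cdot>\<^sub>m (A + 1\<^sub>m 2) | s. s\<^sup>2 = tr A + 2}" and
    neg: "{B \<in> sqrt_mats A. det B = -1} =
      {inverse s \<cdot>\<^sub>m (A - 1\<^sub>m 2) | s. s\<^sup>2 = tr A - 2}"
    using sqrt_mats_det_eq[OF assms(1), of 1] sqrt_mats_det_eq[OF assms(1), of "-1"] plus minus
    by simp_all
  show "sqrt_mats A =
      {inverse s \<cdot>\<^sub>m (A + 1\<^sub>m 2) | s. s\<^sup>2 = tr A + 2} \<union>
      {inverse s \<cdot>\<^sub>m (A - 1\<^sub>m 2) | s. s\<^sup>2 = tr A - 2}"
    unfolding pos[symmetric] neg[symmetric] using det_sqrt_mats[OF assms(1)] by blast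
  \<comment> \<open>The minus family consists of the roots of determinant -1, hence of invertible
    matrices.\<close>
  show "{inverse s \<cdot>\<^sub>m (A - 1\<^sub>m 2) | s. s\<^sup>2 = tr A - 2} \<subseteq> ESL2"
    unfolding neg[symmetric]
    by (auto simp: ESL2_def GL2_def sqrt_mats_def intro!: invertible_mat_if_det_nonzero)
  fix a b c d s
  assume "A = mat2 a b c d" and s: "s\<^sup>2 = tr A + 2"
  then have M: "mat2 (a + 1) b c (d + 1) = A + 1\<^sub>m 2" by (simp add: mat2_add_one)
  have "sqrt_mats A \<inter> SL2 = {B \<in> sqrt_mats A. det B = 1}"
    by (auto simp: sqrt_mats_def SL2_def)
  \<comment> \<open>The given \<open>s\<close> fixes one square root of \<open>tr A + 2\<close>; any
    other \<open>r\<close> satisfies \<open>r\<^sup>2 = s\<^sup>2\<close> and so is \<open>s\<close>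
    or \<open>- s\<close>.\<close>
  also have "\<dots> = {inverse r \<cdot>\<^sub>m (A + 1\<^sub>m 2) | r. r = s \<or> r = - s}"
    by (simp add: pos power2_eq_iff flip: s)
  finally show "sqrt_mats A \<inter> SL2 =
      {inverse s \<cdot>\<^sub>m mat2 (a + 1) b c (d + 1), inverse (- s) \<cdot>\<^sub>m mat2 (a + 1) b c (d + 1)}"
    unfolding M by blast
qed

end
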